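(* Let $(x_k)_{k\ge0}$ be generated by Anderson acceleration AA(1) from an initial guess $x_0\in\mathbb{R}^n$, applied to the linear fixed-point function $q(x)=Mx+b$, with residuals $r_k=x_k-q(x_k)$. Assume that $r_k\neq r_{k-1}$ for all $k\ge1$. Then $$ r_k=L_kr_0,\qquad k=0,1,\ldots, $$ with $L_0=I$, $L_1=M$ and $$ L_{k+1}=\frac{1}{\|(L_k-L_{k-1})r_0\|^2}\,M\big(-L_kR_0L_{k-1}^T+(L_kR_0L_{k-1}^T)^T\big)(L_k-L_{k-1}),\qquad k\ge1, $$ where $R_0=r_0r_0^T$.
   Context: Setting: $M\in\mathbb{R}^{n\times n}$, $b\in\mathbb{R}^n$, $q(x)=Mx+b$, $A=I-M$ is nonsingular and $M\neq 0$. $\|\cdot\|$ is the 2-norm. The residual is $r(x)=x-q(x)=Ax-b$ and $r_k=r(x_k)$. AA(1): given $x_0\in\mathbb{R}^n$, set $x_1=q(x_0)$ and for $k\ge1$ $$x_{k+1}=(1+\beta_k)q(x_k)-\beta_kq(x_{k-1}),\qquad \beta_k=\frac{-r_k^T(r_k-r_{k-1})}{\|r_k-r_{k-1}\|^2}\ \text{ if } r_k\ne r_{k-1},$$ and $\beta_k=0$ if $r_k=r_{k-1}$. *)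

theory Defs
  imports "HOL-Analysis.Analysis"
begin

definition residual :: "('a::real_inner \<Rightarrow> 'a) \<Rightarrow> 'a \<Rightarrow> 'a" where
  "residual q x = x - q x"

text \<open>The coefficient \<open>\<beta>\<^sub>k\<close> as a function of the current point \<open>x = x\<^sub>k\<close> and the previous
  point \<open>y = x\<^sub>k\<^sub>-\<^sub>1\<close>.\<close>

definition aa1_beta :: "('a::real_inner \<Rightarrow> 'a) \<Rightarrow> 'a \<Rightarrow> 'a \<Rightarrow> real" where
  "aa1_beta q x y =
     (if residual q x \<noteq> residual q y
      then - (residual q x \<bullet> (residual q x - residual q y)) / (norm (residual q x - residual q y))\<^sup>2
      else 0)"

fun aa1 :: "('a::real_inner \<Rightarrow> 'a) \<Rightarrow> 'a \<Rightarrow> nat \<Rightarrow> 'a" where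
  "aa1 q x0 0 = x0"
| "aa1 q x0 (Suc 0) = q x0"
| "aa1 q x0 (Suc (Suc k)) =
     (1 + aa1_beta q (aa1 q x0 (Suc k)) (aa1 q x0 k)) *\<^sub>R q (aa1 q x0 (Suc k))
     - aa1_beta q (aa1 q x0 (Suc k)) (aa1 q x0 k) *\<^sub>R q (aa1 q x0 k)"

definition outer_product :: "real ^ 'm \<Rightarrow> real ^ 'n \<Rightarrow> real ^ 'n ^ 'm" where
  "outer_product u v = (\<chi> i j. u $ i * v $ j)"

text \<open>The last equation is the recursion for \<open>L\<^sub>k\<^sub>+\<^sub>1\<close>, \<open>k \<ge> 1\<close>, with \<open>k\<close> shifted by one. If the
  denominator vanishes it yields \<open>0\<close>; this does not happen as long as consecutive residuals
  \<open>L\<^sub>k r\<^sub>0\<close> are distinct.\<close>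

fun aa1_L :: "real ^ 'n ^ 'n \<Rightarrow> real ^ 'n \<Rightarrow> nat \<Rightarrow> real ^ 'n ^ 'n" where
  "aa1_L M r0 0 = mat 1"
| "aa1_L M r0 (Suc 0) = M"
| "aa1_L M r0 (Suc (Suc k)) =
     (let L = aa1_L M r0 (Suc k); L' = aa1_L M r0 k; R0 = outer_product r0 r0
      in (1 / (norm ((L - L') *v r0))\<^sup>2) *\<^sub>R
           (M ** (- (L ** R0 ** transpose L') + transpose (L ** R0 ** transpose L')) ** (L - L')))"

end

theory Submission
  imports Defs
begin

text \<open>
  For an affine map \<open>q\<close> the residual commutes with affine combinations, and applying \<open>q\<close>
  multiplies the residual by \<open>M\<close>. Hence AA(1) acts on residuals alone: with
  \<open>d = r\<^sub>k - r\<^sub>k\<^sub>-\<^sub>1\<close>, the residual \<open>r\<^sub>k\<^sub>+\<^sub>1\<close> is \<open>M\<close> applied to \<open>r\<^sub>k + \<beta>\<^sub>k d\<close>, which is the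
  component of \<open>r\<^sub>k\<close> orthogonal to \<open>d\<close>. In the plane spanned by \<open>u = r\<^sub>k\<close> and \<open>v = r\<^sub>k\<^sub>-\<^sub>1\<close> this
  orthogonal component, scaled by \<open>\<parallel>d\<parallel>\<^sup>2\<close>, is obtained by applying the skew-symmetric matrix
  \<open>v u\<^sup>T - u v\<^sup>T\<close> to \<open>d\<close>
  (a skew-symmetric matrix sends every vector to an orthogonal one; see
  lemma \<open>skew_outer_product_mult_diff\<close>). Once \<open>u = L\<^sub>k r\<^sub>0\<close> and \<open>v = L\<^sub>k\<^sub>-\<^sub>1 r\<^sub>0\<close> are known,
  \<open>u v\<^sup>T = L\<^sub>k R\<^sub>0 L\<^sub>k\<^sub>-\<^sub>1\<^sup>T\<close>, and the recursion for \<open>L\<^sub>k\<close> is this identity read as a matrix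
  applied to \<open>r\<^sub>0\<close>.
\<close>

lemma outer_product_mult_vector:
  "outer_product u v *v w = (v \<bullet> w) *\<^sub>R u"
  by (simp add: outer_product_def matrix_vector_mult_def inner_vec_def vec_eq_iff
      sum_distrib_left mult_ac)

lemma transpose_outer_product:
  "transpose (outer_product u v) = outer_product v u"
  by (simp add: outer_product_def transpose_def vec_eq_iff mult_ac)

lemma matrix_mult_outer_product:
  "A ** outer_product u v ** transpose B = outer_product (A *v u) (B *v v)"
proof -
  have "(A ** outer_product u v ** transpose B) *v w = outer_product (A *v u) (B *v v) *v w" for w
    by (simp add: matrix_vector_mul_assoc [symmetric] outer_product_mult_vector
        matrix_vector_mult_scaleR inner_commute [of v] inner_commute [of "B *v v"] dot_lmul_matrix)
  then show ?thesis
    by (simp add: matrix_eq)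
qed

text \<open>The right-hand side is the part of \<open>u\<close> orthogonal to \<open>u - v\<close>, scaled by
  \<open>\<parallel>u - v\<parallel>\<^sup>2\<close>. Expanding \<open>\<parallel>u - v\<parallel>\<^sup>2 = u \<bullet> (u - v) - v \<bullet> (u - v)\<close> cancels the
  \<open>u \<bullet> (u - v)\<close> contribution to the coefficient of \<open>u\<close>, which leaves the two rank-one terms
  on the left.\<close>

lemma skew_outer_product_mult_diff:
  "(- outer_product u v + outer_product v u) *v (u - v) =
    (norm (u - v))\<^sup>2 *\<^sub>R u - (u \<bullet> (u - v)) *\<^sub>R (u - v)"
proof -
  have "(- outer_product u v + outer_product v u) *v (u - v) =
      (u \<bullet> (u - v)) *\<^sub>R v - (v \<bullet> (u - v)) *\<^sub>R u"
    by (simp add: matrix_vector_mult_diff_rdistrib outer_product_mult_vector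
        del: matrix_vector_mult_diff_distrib)
  moreover have "(norm (u - v))\<^sup>2 = u \<bullet> (u - v) - v \<bullet> (u - v)"
    by (simp add: power2_norm_eq_inner inner_diff_left)
  ultimately show ?thesis
    by (simp add: scaleR_diff_left scaleR_diff_right)
qed

text \<open>The coefficients sum to \<open>1\<close>, so the constant term of the affine residual is
  preserved.\<close>

lemma residual_affine_combination:
  fixes M :: "real ^ 'n ^ 'n"
  assumes q: "\<And>v. q v = M *v v + b"
  shows "residual q ((1 + t) *\<^sub>R q y - t *\<^sub>R q z) =
    M *v (residual q y + t *\<^sub>R (residual q y - residual q z))"
  by (simp add: residual_def q matrix_vector_mult_scaleR matrix_vector_mult_add_rdistrib
      matrix_vector_right_distrib matrix_vector_mult_diff_distrib algebra_simps)

text \<open>The choice of \<open>\<beta>\<^sub>k\<close> makes the argument of \<open>M\<close> the projection of the current residual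
  onto the orthogonal complement of the last residual difference, which the skew-symmetric
  matrix produces as well. This is the recursion for \<open>L\<^sub>k\<close> evaluated at \<open>r\<^sub>0\<close>.\<close>

lemma aa1_residual_step:
  fixes M :: "real ^ 'n ^ 'n" and q :: "real ^ 'n \<Rightarrow> real ^ 'n" and x0 :: "real ^ 'n"
  defines "u \<equiv> \<lambda>j. residual q (aa1 q x0 j)"
  assumes q: "\<And>v. q v = M *v v + b"
    and ne: "u (Suc k) \<noteq> u k"
  shows "u (Suc (Suc k)) =
    (1 / (norm (u (Suc k) - u k))\<^sup>2) *\<^sub>R
      (M *v ((- outer_product (u (Suc k)) (u k)
              + outer_product (u k) (u (Suc k))) *v (u (Suc k) - u k)))"
proof -
  let ?u = "u (Suc k)" and ?v = "u k"
  let ?n = "(norm (?u - ?v))\<^sup>2"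
  have n: "?n \<noteq> 0"
    using ne by simp
  have beta: "aa1_beta q (aa1 q x0 (Suc k)) (aa1 q x0 k) = - (?u \<bullet> (?u - ?v)) / ?n"
    using ne by (simp add: aa1_beta_def u_def)
  have "u (Suc (Suc k)) = M *v (?u + (- (?u \<bullet> (?u - ?v)) / ?n) *\<^sub>R (?u - ?v))"
    unfolding u_def aa1.simps residual_affine_combination [OF q]
    by (simp only: beta [unfolded u_def])
  also have "?u + (- (?u \<bullet> (?u - ?v)) / ?n) *\<^sub>R (?u - ?v) =
      (1 / ?n) *\<^sub>R (?n *\<^sub>R ?u - (?u \<bullet> (?u - ?v)) *\<^sub>R (?u - ?v))"
    using n by (simp add: scaleR_diff_right [of _ "_ *\<^sub>R _"])
  finally show ?thesis
    by (simp only: skew_outer_product_mult_diff matrix_vector_mult_scaleR)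
qed

theorem proposition3p4:
  fixes M :: "real ^ 'n ^ 'n" and b x0 :: "real ^ 'n"
    and q :: "real ^ 'n \<Rightarrow> real ^ 'n" and x r :: "nat \<Rightarrow> real ^ 'n"
  assumes q: "\<And>v. q v = M *v v + b"
    and A: "invertible (mat 1 - M)"
    and M: "M \<noteq> 0"
    and x: "\<And>k. x k = aa1 q x0 k"
    and r: "\<And>k. r k = residual q (x k)"
    and distinct: "\<And>k. k \<ge> 1 \<Longrightarrow> r k \<noteq> r (k - 1)"
  shows "\<forall>k. r k = aa1_L M (r 0) k *v r 0"
proof
  fix k
  have ra: "r j = residual q (aa1 q x0 j)" for j
    by (simp add: r x)
  show "r k = aa1_L M (r 0) k *v r 0"
  proof (induction k rule: induct_nat_012)
    case 0
    show ?case by simp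
  next
    case 1
    (* The first Picard step is the affine combination with t = 0. *)
    show ?case
      using residual_affine_combination [OF q, of 0 x0 x0] by (simp add: ra)
  next
    case (ge2 k)
    let ?L = "aa1_L M (r 0) (Suc k)" and ?L' = "aa1_L M (r 0) k"
    have diff: "(?L - ?L') *v r 0 = r (Suc k) - r k"
      by (simp only: matrix_vector_mult_diff_rdistrib ge2.IH [symmetric])
    have outer: "?L ** outer_product (r 0) (r 0) ** transpose ?L' = outer_product (r (Suc k)) (r k)"
      by (simp only: matrix_mult_outer_product ge2.IH [symmetric])
    have "residual q (aa1 q x0 (Suc k)) \<noteq> residual q (aa1 q x0 k)"
      using distinct [of "Suc k"] by (simp add: ra)
    from aa1_residual_step [OF q this]
    have "r (Suc (Suc k)) = (1 / (norm (r (Suc k) - r k))\<^sup>2) *\<^sub>R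
      (M *v ((- outer_product (r (Suc k)) (r k) + outer_product (r k) (r (Suc k)))
        *v (r (Suc k) - r k)))"
      by (simp only: ra)
    also have "\<dots> = aa1_L M (r 0) (Suc (Suc k)) *v r 0"
      by (simp only: aa1_L.simps Let_def outer transpose_outer_product
          scaleR_matrix_vector_assoc [symmetric] matrix_vector_mul_assoc [symmetric] diff)
    finally show ?case .
  qed
qed

end
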